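(* Let $g(x,z)=\exp((x^2+1)\ln z)=z^{x^2+1}$ for $z>0$. Let $W\subset\mathbb{R}^3$ be the graph $\{(x,y,z): y=g(x,z)\}$ of $g$ for $z>0$ and $x$, $z$ small, and let $X$ be the $x$-axis. Then the conditions $(b^* )$ and $(r^* )$ fail for $(W,X)$ at $(0,0,0)$.
   Context: Let $\pi$ be the orthogonal projection (nearest point retraction) onto $X$ and, for linear subspaces $E,F$, $\delta(E,F)=\sup_{u\in E,|u|=1}d(u,F)$. For a $C^2$ submanifold $Y$ disjoint from $X$ with $0\in\mathrm{cl}(Y)$: - $(Y,X)$ satisfies $(b)$ at $0$ if, as $y\to0$ in $Y$, $\delta(T_{\pi(y)}X,T_yY)\to0$ and $\sup\{\langle\nu,\tfrac{\pi(y)-y}{|\pi(y)-y|}\rangle:\nu\in(T_yY)^\perp,|\nu|=1\}\to0$. - $(Y,X)$ satisfies $(r)$ at $0$ if $\dfrac{|y|\,\delta(T_{\pi(y)}X,T_yY)}{|y-\pi(y)|}\to0$ as $y\to 0$ in $Y$. Let $E$ be one of the conditions $(b)$, $(r)$. For $0<k<\operatorname{cod}X$, the pair $(Y,X)$ in the manifold $M$ is $E_{\mathrm{cod}\,k}$-regular at $x\in X$ if there is an open dense subset $U_k$ of the Grassmannian of codimension $k$ subspaces of $T_xM$ containing $T_xX$ such that, whenever $N$ is a $C^2$ submanifold of $M$ with $X\subset N$ near $x$ and $T_xN\in U_k$, then $N$ is transverse to $Y$ near $x$ and $(Y\cap N,X)$ is $E$-regular at $x$. The pair is $E^*$-regular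 at $x$ if it is $E_{\mathrm{cod}\,k}$-regular for all $k$ with $0<k<\operatorname{cod}X$. Here $M=\mathbb{R}^3$, $\operatorname{cod}X=2$, so only $k=1$ occurs. *)

theory Defs
  imports "HOL-Analysis.Analysis"
begin

definition C2_on :: "'a::euclidean_space set \<Rightarrow> ('a \<Rightarrow> 'b::euclidean_space) \<Rightarrow> bool" where
  "C2_on U f \<longleftrightarrow>
    (\<exists>(f' :: 'a \<Rightarrow> 'a \<Rightarrow>\<^sub>L 'b) (f'' :: 'a \<Rightarrow> 'a \<Rightarrow>\<^sub>L ('a \<Rightarrow>\<^sub>L 'b)).
      (\<forall>x\<in>U. (f has_derivative blinfun_apply (f' x)) (at x)) \<and>
      (\<forall>x\<in>U. (f' has_derivative blinfun_apply (f'' x)) (at x)) \<and>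
      continuous_on U f'')"

text \<open>Embedded submanifolds of pure dimension d, given by slice charts.\<close>

definition C2_submanifold :: "nat \<Rightarrow> 'a::euclidean_space set \<Rightarrow> bool" where
  "C2_submanifold d S \<longleftrightarrow>
    (\<forall>p\<in>S. \<exists>(U :: 'a set) (V :: 'a set) \<phi> \<psi> (L :: 'a set).
      open U \<and> p \<in> U \<and> open V \<and> homeomorphism U V \<phi> \<psi> \<and> C2_on U \<phi> \<and> C2_on V \<psi> \<and>
      subspace L \<and> dim L = d \<and> \<phi> ` (S \<inter> U) = L \<inter> V)"

text \<open>Velocities at p of curves in S through p. At a point of a submanifold this is the
  usual tangent space; differentiability of the curve at the one parameter value suffices.\<close>

definition tangent_space :: "'a::euclidean_space set \<Rightarrow> 'a \<Rightarrow> 'a set" where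
  "tangent_space S p =
    {v. \<exists>(c :: real \<Rightarrow> 'a) e. e > 0 \<and> c 0 = p \<and> (\<forall>t. \<bar>t\<bar> < e \<longrightarrow> c t \<in> S) \<and>
        (c has_vector_derivative v) (at 0)}"

definition transverse_near :: "'a::euclidean_space set \<Rightarrow> 'a set \<Rightarrow> 'a \<Rightarrow> bool" where
  "transverse_near N Y x \<longleftrightarrow>
    (\<forall>\<^sub>F p in nhds x. p \<in> N \<inter> Y \<longrightarrow>
      {u + v | u v. u \<in> tangent_space N p \<and> v \<in> tangent_space Y p} = UNIV)"

text \<open>In the next two suprema all elements are bounded, and the inserted 0 matters only when
  there is no unit vector to range over (the supremum of the empty set of reals is unspecified):
  distances are nonnegative, and the set of unit normals is symmetric.\<close>

definition delta :: "'a::euclidean_space set \<Rightarrow> 'a set \<Rightarrow> real" where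
  "delta E F = Sup (insert 0 {infdist u F | u. u \<in> E \<and> norm u = 1})"

definition normal_part :: "'a::euclidean_space set \<Rightarrow> 'a \<Rightarrow> real" where
  "normal_part T s = Sup (insert 0 {\<nu> \<bullet> s | \<nu>. \<nu> \<in> T\<^sup>\<bottom> \<and> norm \<nu> = 1})"

text \<open>The standing assumptions on the pair (Y a submanifold disjoint from X with x in its
  closure) are not part of the two conditions below. The retraction onto X is the library's
  closest_point, which is determined when X is closed and convex, e.g. a linear subspace.\<close>

definition condition_b :: "'a::euclidean_space set \<Rightarrow> 'a set \<Rightarrow> 'a \<Rightarrow> bool" where
  "condition_b Y X x \<longleftrightarrow>
    ((\<lambda>y. delta (tangent_space X (closest_point X y)) (tangent_space Y y)) \<longlongrightarrow> 0)
      (at x within Y) \<and>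
    ((\<lambda>y. normal_part (tangent_space Y y)
        ((closest_point X y - y) /\<^sub>R norm (closest_point X y - y))) \<longlongrightarrow> 0)
      (at x within Y)"

definition condition_r :: "'a::euclidean_space set \<Rightarrow> 'a set \<Rightarrow> 'a \<Rightarrow> bool" where
  "condition_r Y X x \<longleftrightarrow>
    ((\<lambda>y. norm (y - x) * delta (tangent_space X (closest_point X y)) (tangent_space Y y)
        / norm (y - closest_point X y)) \<longlongrightarrow> 0)
      (at x within Y)"

text \<open>A subspace P is identified with its orthogonal projection, closest_point P. The topology on
  functions is that of pointwise convergence, which on linear maps between
  finite-dimensional spaces is the norm topology.\<close>

definition grassmannian :: "nat \<Rightarrow> 'a::euclidean_space set \<Rightarrow> 'a set topology" where
  "grassmannian k T =
    pullback_topology {P. subspace P \<and> dim P + k = DIM('a) \<and> T \<subseteq> P} closest_point euclidean"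

definition cod_regular ::
  "('a::euclidean_space set \<Rightarrow> 'a set \<Rightarrow> 'a \<Rightarrow> bool) \<Rightarrow> nat \<Rightarrow> 'a set \<Rightarrow> 'a set \<Rightarrow> 'a \<Rightarrow> bool" where
  "cod_regular E k Y X x \<longleftrightarrow>
    (\<exists>\<U>. openin (grassmannian k (tangent_space X x)) \<U> \<and>
         grassmannian k (tangent_space X x) closure_of \<U>
           = topspace (grassmannian k (tangent_space X x)) \<and>
         (\<forall>N. C2_submanifold (DIM('a) - k) N \<and> (\<forall>\<^sub>F p in nhds x. p \<in> X \<longrightarrow> p \<in> N) \<and>
              tangent_space N x \<in> \<U> \<longrightarrow>
              transverse_near N Y x \<and> E (Y \<inter> N) X x))"

definition star_regular ::
  "('a::euclidean_space set \<Rightarrow> 'a set \<Rightarrow> 'a \<Rightarrow> bool) \<Rightarrow> 'a set \<Rightarrow> 'a set \<Rightarrow> 'a \<Rightarrow> bool" where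
  "star_regular E Y X x \<longleftrightarrow>
    (\<forall>k. 0 < k \<and> k < DIM('a) - dim (tangent_space X x) \<longrightarrow> cod_regular E k Y X x)"

definition g :: "real \<Rightarrow> real \<Rightarrow> real" where
  "g x z = exp ((x\<^sup>2 + 1) * ln z)"

definition W :: "real \<Rightarrow> (real^3) set" where
  "W \<epsilon> = {vector [x, g x z, z] | x z. \<bar>x\<bar> < \<epsilon> \<and> 0 < z \<and> z < \<epsilon>}"

definition x_axis :: "(real^3) set" where
  "x_axis = {vector [t, 0, 0] | t. True}"

end

theory Submission
  imports Defs "HOL-Real_Asymp.Real_Asymp"
begin

text \<open>On W the ratio of the last two coordinates is \<open>y / z = z powr x\<^sup>2\<close>, which takes every value
  \<open>a\<close> between 0 and 1 arbitrarily close to the origin. The planes \<open>y = a * z\<close> with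
  \<open>0 < a < 1\<close> form an open subset of the Grassmannian, so a dense set contains one of them, and
  such a plane meets W in the flat curve \<open>z = exp (ln a / x\<^sup>2)\<close>. The curve is tangent to the
  x-axis while the secants to the axis are orthogonal to it, so (b) fails. With slope m the
  quotient in (r) is comparable to \<open>x * m / z = - 2 * ln a / x\<^sup>2\<close>, so (r) fails.\<close>

section \<open>Lower bounds for the two suprema from one normal vector\<close>

text \<open>Cauchy-Schwarz bounds the set by \<open>norm s\<close>, so its supremum dominates the
  value at the normalised \<open>\<nu>\<close>.\<close>

lemma normal_part_ge:
  assumes "\<nu> \<in> T\<^sup>\<bottom>" "\<nu> \<noteq> 0"
  shows "\<nu> \<bullet> s / norm \<nu> \<le> normal_part T s"
  unfolding normal_part_def
proof (rule cSup_upper)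
  have "\<nu> /\<^sub>R norm \<nu> \<in> T\<^sup>\<bottom>"
    using assms(1) by (intro subspace_scale subspace_orthogonal_comp)
  moreover have "norm (\<nu> /\<^sub>R norm \<nu>) = 1"
    using assms(2) by simp
  moreover have "\<nu> \<bullet> s / norm \<nu> = (\<nu> /\<^sub>R norm \<nu>) \<bullet> s"
    by (simp add: divide_inverse_commute)
  ultimately show "\<nu> \<bullet> s / norm \<nu> \<in> insert 0 {\<nu> \<bullet> s |\<nu>. \<nu> \<in> T\<^sup>\<bottom> \<and> norm \<nu> = 1}"
    by blast
  show "bdd_above (insert 0 {\<nu> \<bullet> s |\<nu>. \<nu> \<in> T\<^sup>\<bottom> \<and> norm \<nu> = 1})"
  proof (rule bdd_aboveI[of _ "norm s"])
    fix r assume "r \<in> insert 0 {\<nu> \<bullet> s |\<nu>. \<nu> \<in> T\<^sup>\<bottom> \<and> norm \<nu> = 1}"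
    then show "r \<le> norm s"
      by (auto intro: order_trans[OF norm_cauchy_schwarz])
  qed
qed

text \<open>\<open>F\<close> lies in the hyperplane orthogonal to \<open>\<nu>\<close>, so
  \<open>u\<close> is at least as far from \<open>F\<close> as from that hyperplane.\<close>

lemma delta_ge:
  assumes "u \<in> E" "norm u = 1" "0 \<in> F" "\<nu> \<in> F\<^sup>\<bottom>" "\<nu> \<noteq> 0"
  shows "u \<bullet> \<nu> / norm \<nu> \<le> delta E F"
proof -
  \<comment> \<open>\<open>0 \<in> F\<close> excludes the default value 0 of \<open>infdist\<close>
    on the empty set.\<close>
  have "u \<bullet> \<nu> / norm \<nu> \<le> infdist u F"
    unfolding infdist_notempty[OF ex_in_conv[THEN iffD1, OF exI, OF assms(3)]]
  proof (rule cINF_greatest)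
    fix v assume "v \<in> F"
    then have "v \<bullet> \<nu> = 0"
      using assms(4) by (auto simp: orthogonal_comp_def orthogonal_def)
    then have "u \<bullet> \<nu> = (u - v) \<bullet> \<nu>"
      by (simp add: inner_diff_left)
    also have "\<dots> \<le> dist u v * norm \<nu>"
      by (metis dist_norm norm_cauchy_schwarz)
    finally show "u \<bullet> \<nu> / norm \<nu> \<le> dist u v"
      using assms(5) by (simp add: divide_le_eq)
  qed (use assms(3) in auto)
  also have "\<dots> \<le> delta E F"
    unfolding delta_def
  proof (rule cSup_upper)
    show "bdd_above (insert 0 {infdist u F |u. u \<in> E \<and> norm u = 1})"
    proof (rule bdd_aboveI[of _ 1])
      fix r assume "r \<in> insert 0 {infdist u F |u. u \<in> E \<and> norm u = 1}"
      then show "r \<le> 1"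
        by (auto intro: order_trans[OF infdist_le[OF assms(3)]])
    qed
  qed (use assms in blast)
  finally show ?thesis .
qed

section \<open>Tangent spaces and charts of linear subspaces\<close>

text \<open>Straight lines realise every vector of \<open>S\<close> as a velocity. Conversely,
  difference quotients of a curve in \<open>S\<close> stay in \<open>S\<close>, which is
  closed.\<close>

lemma tangent_space_subspace:
  fixes S :: "'a::euclidean_space set"
  assumes S: "subspace S" and p: "p \<in> S"
  shows "tangent_space S p = S"
proof
  show "S \<subseteq> tangent_space S p"
  proof
    fix v assume "v \<in> S"
    then have "p + t *\<^sub>R v \<in> S" for t
      using S p by (simp add: subspace_add subspace_scale)
    moreover have "((\<lambda>t. p + t *\<^sub>R v) has_vector_derivative v) (at 0)"
      by (auto intro!: derivative_eq_intros)
    ultimately show "v \<in> tangent_space S p"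
      unfolding tangent_space_def
      by (intro CollectI exI[of _ "\<lambda>t. p + t *\<^sub>R v"] exI[of _ 1]) auto
  qed
  show "tangent_space S p \<subseteq> S"
  proof
    fix v assume "v \<in> tangent_space S p"
    then obtain c e where e: "e > 0" and c0: "c 0 = p" and c: "\<And>t. \<bar>t\<bar> < e \<Longrightarrow> c t \<in> S"
      and d: "(c has_vector_derivative v) (at 0)"
      unfolding tangent_space_def by blast
    have "norm (c h - c 0 - h *\<^sub>R v) / norm h = norm ((c h - c 0) /\<^sub>R h - v)" if "h \<noteq> 0" for h
    proof -
      have "(c h - c 0) /\<^sub>R h - v = (c h - c 0 - h *\<^sub>R v) /\<^sub>R h"
        using that by (simp add: scaleR_right_diff_distrib)
      then show ?thesis
        by (simp add: divide_inverse_commute)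
    qed
    then have "\<forall>\<^sub>F h in at 0. norm (c h - c 0 - h *\<^sub>R v) / norm h = norm ((c h - c 0) /\<^sub>R h - v)"
      by (rule eventually_mono[OF eventually_neq_at_within])
    moreover have "((\<lambda>h. norm (c h - c 0 - h *\<^sub>R v) / norm h) \<longlongrightarrow> 0) (at 0)"
      using d by (simp add: has_vector_derivative_def has_derivative_at)
    ultimately have "((\<lambda>h. norm ((c h - c 0) /\<^sub>R h - v)) \<longlongrightarrow> 0) (at 0)"
      by (rule Lim_transform_eventually[rotated])
    then have "((\<lambda>h. (c h - c 0) /\<^sub>R h) \<longlongrightarrow> v) (at 0)"
      by (rule LIM_zero_cancel[OF tendsto_norm_zero_cancel])
    moreover have "\<forall>\<^sub>F h in at 0. (c h - c 0) /\<^sub>R h \<in> S"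
      unfolding eventually_at
    proof (intro exI conjI ballI impI)
      fix h :: real assume "h \<noteq> 0 \<and> dist h 0 < e"
      then have "c h \<in> S" "c 0 \<in> S"
        using c[of h] c[of 0] e by auto
      then show "(c h - c 0) /\<^sub>R h \<in> S"
        by (intro subspace_scale subspace_diff S)
    qed (rule e)
    ultimately show "v \<in> S"
      by (intro Lim_in_closed_set[OF closed_subspace[OF S] _ trivial_limit_at])
  qed
qed

lemma C2_on_id: "C2_on U (\<lambda>x. x)"
  unfolding C2_on_def
  by (intro exI[of _ "\<lambda>_. id_blinfun"] exI[of _ "\<lambda>_. 0"]) (auto simp: zero_blinfun.rep_eq)

lemma C2_submanifold_subspace:
  assumes "subspace S"
  shows "C2_submanifold (dim S) S"
  unfolding C2_submanifold_def
  by (intro ballI exI[of _ UNIV] exI[of _ "\<lambda>x. x"] exI[of _ S])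
    (use assms in \<open>auto simp: C2_on_id homeomorphism_def\<close>)

section \<open>Planes through the x-axis and orthogonal projections\<close>

text \<open>As \<open>a\<close> varies, these are all planes through the x-axis except the one where
  the third coordinate vanishes.\<close>

definition plane :: "real \<Rightarrow> (real^3) set" where
  "plane a = {v. v $ 2 = a * v $ 3}"

lemma plane_hyperplane: "plane a = {v. vector [0, 1, -a] \<bullet> v = 0}"
  by (auto simp: plane_def inner_vec_def sum_3)

lemma subspace_plane: "subspace (plane a)"
  unfolding plane_hyperplane by (rule subspace_hyperplane)

lemma dim_plane: "dim (plane a) = 2"
proof -
  have "(vector [0, 1, -a] :: real^3) \<noteq> 0"
    by (metis vector_3(2) zero_index zero_neq_one)
  then show ?thesis
    unfolding plane_hyperplane by (subst dim_hyperplane) auto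
qed

lemma x_axis_eq_span: "x_axis = span {axis 1 1}"
  by (auto simp: x_axis_def span_singleton vec_eq_iff forall_3 axis_def)

lemma subspace_x_axis: "subspace x_axis"
  by (simp add: x_axis_eq_span)

lemma dim_x_axis: "dim x_axis = 1"
  by (simp add: x_axis_eq_span dim_span dim_singleton)

text \<open>By Pythagoras the foot of the perpendicular is nearest; closedness and convexity make it
  unique.\<close>

lemma closest_point_subspace_eqI:
  fixes S :: "'a::euclidean_space set"
  assumes "subspace S" "w \<in> S" "\<And>v. v \<in> S \<Longrightarrow> (y - w) \<bullet> v = 0"
  shows "closest_point S y = w"
proof (rule closest_point_unique[symmetric])
  show "\<forall>v\<in>S. dist y w \<le> dist y v"
  proof
    fix v assume "v \<in> S"
    then have "(y - w) \<bullet> (w - v) = 0"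
      using assms by (simp add: subspace_diff)
    then have "(norm (y - w))\<^sup>2 \<le> (norm (y - v))\<^sup>2"
      using norm_add_Pythagorean[of "y - w" "w - v"] by (simp add: orthogonal_def)
    then show "dist y w \<le> dist y v"
      by (simp add: dist_norm)
  qed
qed (use assms in \<open>auto simp: subspace_imp_convex closed_subspace\<close>)

text \<open>The orthogonal decomposition of \<open>y\<close> supplies a foot of the perpendicular,
  and the preceding criterion identifies it with the closest point.\<close>

lemma closest_point_subspace_orthogonal:
  fixes S :: "'a::euclidean_space set"
  assumes "subspace S" "v \<in> S"
  shows "(y - closest_point S y) \<bullet> v = 0"
proof -
  obtain w z where "w \<in> S" "\<And>u. u \<in> S \<Longrightarrow> orthogonal z u" "y = w + z"
    using orthogonal_subspace_decomp_exists[of S y] assms(1) span_eq_iff by metis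
  then show ?thesis
    using closest_point_subspace_eqI[of S w y] assms
    by (simp add: orthogonal_def)
qed

lemma closest_point_x_axis: "closest_point x_axis y = vector [y $ 1, 0, 0]"
proof (rule closest_point_subspace_eqI[OF subspace_x_axis])
  show "vector [y $ 1, 0, 0] \<in> x_axis"
    by (auto simp: x_axis_def)
  show "(y - vector [y $ 1, 0, 0]) \<bullet> v = 0" if "v \<in> x_axis" for v
    using that by (auto simp: x_axis_def inner_vec_def sum_3)
qed

section \<open>Dense sets in the Grassmannian\<close>

lemma topspace_grassmannian:
  "topspace (grassmannian k T) = {P :: 'a::euclidean_space set. subspace P \<and> dim P + k = DIM('a) \<and> T \<subseteq> P}"
  by (simp add: grassmannian_def topspace_pullback_topology)

lemma plane_in_grassmannian: "plane a \<in> topspace (grassmannian 1 x_axis)"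
  unfolding topspace_grassmannian
  by (auto simp: subspace_plane dim_plane) (auto simp: plane_def x_axis_def)

text \<open>Density is applied to a single open neighbourhood of \<open>plane (1/2)\<close>, all of
  whose members have slope in (0,1).\<close>

lemma dense_grassmannian_contains_plane:
  assumes "grassmannian 1 x_axis closure_of \<U> = topspace (grassmannian 1 x_axis)"
  obtains a where "0 < a" "a < 1" "plane a \<in> \<U>"
proof -
  \<comment> \<open>The projection of the second basis vector to \<open>plane a\<close> is (0,
    a^2/(a^2+1), a/(a^2+1)), so the two inequalities encode \<open>0 < a\<close> and
    \<open>a < 1\<close>. Evaluation at a point is continuous for pointwise convergence.\<close>
  define O' where "O' = {f :: real^3 \<Rightarrow> real^3. 0 < f (axis 2 1) $ 3 \<and> f (axis 2 1) $ 2 < 1/2}"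
  define Q where "Q = closest_point -` O' \<inter> topspace (grassmannian 1 x_axis)"
  have "open O'"
    unfolding O'_def by (intro open_Collect_conj open_Collect_less continuous_intros
        continuous_on_product_coordinates)
  then have "openin (grassmannian 1 x_axis) Q"
    unfolding Q_def topspace_grassmannian grassmannian_def openin_pullback_topology
    by (auto intro!: exI[of _ O'] simp: topspace_pullback_topology)
  moreover have "closest_point (plane (1/2)) (axis 2 1) = vector [0, 1/5, 2/5]"
    by (rule closest_point_subspace_eqI[OF subspace_plane])
      (auto simp: plane_def inner_vec_def sum_3 axis_def)
  then have "plane (1/2) \<in> Q"
    using plane_in_grassmannian by (simp add: Q_def O'_def)
  moreover have "plane (1/2) \<in> grassmannian 1 x_axis closure_of \<U>"
    unfolding assms by (rule plane_in_grassmannian)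
  ultimately obtain P where "P \<in> \<U>" "P \<in> Q"
    unfolding in_closure_of by blast
  then have P: "subspace P" "dim P = 2" "x_axis \<subseteq> P"
    by (auto simp: Q_def topspace_grassmannian)
  define w where "w = closest_point P (axis 2 1)"
  have w: "w $ 3 > 0" "w $ 2 < 1/2"
    using \<open>P \<in> Q\<close> by (auto simp: Q_def O'_def w_def)
  have "axis 1 1 \<in> P"
    using P(3) by (auto simp: x_axis_eq_span span_base)
  have "w \<in> P"
    unfolding w_def using P(1) subspace_0 by (intro closest_point_in_set closed_subspace) auto
  \<comment> \<open>Testing the residual against two vectors of \<open>P\<close> gives a vanishing
    first coordinate and \<open>w $ 2\<close> equal to the squared norm of \<open>w\<close>.\<close>
  have "(axis 2 1 - w) \<bullet> axis 1 1 = 0" "(axis 2 1 - w) \<bullet> w = 0"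
    using closest_point_subspace_orthogonal[OF P(1), of _ "axis 2 1", folded w_def]
      \<open>axis 1 1 \<in> P\<close> \<open>w \<in> P\<close> by blast+
  then have w1: "w $ 1 = 0" and w23: "w $ 2 = (w $ 2)\<^sup>2 + (w $ 3)\<^sup>2"
    by (auto simp: inner_vec_def sum_3 axis_def algebra_simps power2_eq_square)
  have "w $ 2 > 0"
    using w(1) zero_le_power2[of "w $ 2"] zero_less_power[of "w $ 3" 2] w23 by linarith
  \<comment> \<open>Since \<open>w $ 2\<close> is the sum of the two squares, the first square is
    below half of the sum, hence below the second.\<close>
  have "(w $ 2)\<^sup>2 < w $ 2 * (1/2)"
    unfolding power2_eq_square using w(2) \<open>w $ 2 > 0\<close> by (rule mult_strict_left_mono)
  then have "(w $ 2)\<^sup>2 < (w $ 3)\<^sup>2"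
    using w23 by linarith
  then have "w $ 2 < w $ 3"
    by (rule power2_less_imp_less) (use w(1) in simp)
  define a where "a = w $ 2 / w $ 3"
  have "plane a \<subseteq> P"
  proof
    fix v assume "v \<in> plane a"
    then have "v = v $ 1 *\<^sub>R axis 1 1 + (v $ 3 / w $ 3) *\<^sub>R w"
      using w w1 by (auto simp: vec_eq_iff forall_3 plane_def a_def axis_def)
    then show "v \<in> P"
      using P(1) \<open>axis 1 1 \<in> P\<close> \<open>w \<in> P\<close>
      by (elim ssubst) (intro subspace_add subspace_scale)
  qed
  \<comment> \<open>Both subspaces have dimension 2, so the inclusion is an equality.\<close>
  then have "plane a = P"
    using P dim_plane subspace_plane by (intro subspace_dim_equal) auto
  moreover have "0 < a" "a < 1"
    using w \<open>w $ 2 > 0\<close> \<open>w $ 2 < w $ 3\<close> by (auto simp: a_def)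
  ultimately show ?thesis
    using that \<open>P \<in> \<U>\<close> by blast
qed

section \<open>The curve cut out of \<open>W\<close> by a plane\<close>

text \<open>Dividing \<open>g x z = a * z\<close> by \<open>z\<close> and taking logarithms gives an
  equation that is easy to solve for \<open>z\<close> and to differentiate.\<close>

lemma W_plane_iff:
  assumes "0 < a"
  shows "p \<in> W \<epsilon> \<inter> plane a \<longleftrightarrow>
    \<bar>p $ 1\<bar> < \<epsilon> \<and> 0 < p $ 3 \<and> p $ 3 < \<epsilon> \<and> p $ 2 = a * p $ 3 \<and> (p $ 1)\<^sup>2 * ln (p $ 3) = ln a"
proof -
  have *: "g x z = a * z \<longleftrightarrow> x\<^sup>2 * ln z = ln a" if "0 < z" for x z
  proof -
    have "a * z = exp (ln a + ln z)"
      using assms that by (simp add: exp_add)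
    moreover have "g x z = exp (x\<^sup>2 * ln z + ln z)"
      by (simp add: g_def algebra_simps)
    ultimately show ?thesis
      by simp
  qed
  have "p \<in> W \<epsilon> \<longleftrightarrow> \<bar>p $ 1\<bar> < \<epsilon> \<and> 0 < p $ 3 \<and> p $ 3 < \<epsilon> \<and> p $ 2 = g (p $ 1) (p $ 3)"
    by (auto simp: W_def vec_eq_iff forall_3)
  then have "p \<in> W \<epsilon> \<inter> plane a \<longleftrightarrow> \<bar>p $ 1\<bar> < \<epsilon> \<and> 0 < p $ 3 \<and> p $ 3 < \<epsilon> \<and> p $ 2 = a * p $ 3 \<and>
      g (p $ 1) (p $ 3) = a * p $ 3"
    by (auto simp: plane_def)
  then show ?thesis
    using *[of "p $ 3" "p $ 1"] by blast
qed

text \<open>Both equations of the curve are differentiated along an arbitrary path in it. This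
  bounds the tangent space from above, which is what certifies normal vectors.\<close>

lemma tangent_space_W_plane:
  assumes "0 < a" "p \<in> W \<epsilon> \<inter> plane a" "p $ 1 \<noteq> 0" "v \<in> tangent_space (W \<epsilon> \<inter> plane a) p"
  shows "v $ 2 = a * v $ 3" "v $ 3 = - 2 * p $ 3 * ln a / (p $ 1) ^ 3 * v $ 1"
proof -
  obtain c e where e: "e > 0" and c0: "c 0 = p"
    and c: "\<And>t. \<bar>t\<bar> < e \<Longrightarrow> c t \<in> W \<epsilon> \<inter> plane a"
    and d: "(c has_vector_derivative v) (at 0)"
    using assms(4) unfolding tangent_space_def by blast
  have D: "((\<lambda>t. c t $ i) has_real_derivative v $ i) (at 0)" for i
    using bounded_linear.has_vector_derivative[OF bounded_linear_vec_nth d]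
    by (simp add: has_real_derivative_iff_has_vector_derivative)
  have near: "\<forall>\<^sub>F t in nhds 0. \<bar>t\<bar> < e"
    unfolding eventually_nhds_metric using e by (auto simp: dist_real_def)
  have const: "f' = 0" if "(f has_real_derivative f') (at 0)" "\<And>t. \<bar>t\<bar> < e \<Longrightarrow> f t = k"
    for f :: "real \<Rightarrow> real" and f' k
  proof -
    have "((\<lambda>_. k) has_real_derivative f') (at 0)"
      using that(1) by (rule DERIV_cong_ev[OF refl _ refl, THEN iffD1, rotated])
        (use near that(2) in \<open>auto elim: eventually_mono\<close>)
    then show ?thesis
      using DERIV_const DERIV_unique by blast
  qed
  have pos: "p $ 3 > 0" and x: "ln (p $ 3) = ln a / (p $ 1)\<^sup>2"
    using assms(2,3) unfolding W_plane_iff[OF assms(1)] by (auto simp: field_simps)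
  have "v $ 2 - a * v $ 3 = 0"
    by (rule const[of "\<lambda>t. c t $ 2 - a * c t $ 3" _ 0])
      (use c W_plane_iff[OF assms(1)] in \<open>auto intro!: derivative_eq_intros D\<close>)
  then show "v $ 2 = a * v $ 3"
    by simp
  have "2 * p $ 1 * v $ 1 * ln (p $ 3) + (p $ 1)\<^sup>2 * (v $ 3 / p $ 3) = 0"
  proof (rule const)
    show "((\<lambda>t. (c t $ 1)\<^sup>2 * ln (c t $ 3)) has_real_derivative
        2 * p $ 1 * v $ 1 * ln (p $ 3) + (p $ 1)\<^sup>2 * (v $ 3 / p $ 3)) (at 0)"
      using pos c0 by (auto intro!: derivative_eq_intros D)
  qed (use c W_plane_iff[OF assms(1)] in blast)
  then show "v $ 3 = - 2 * p $ 3 * ln a / (p $ 1) ^ 3 * v $ 1"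
    unfolding x using assms(3) pos
    by (simp add: field_simps power2_eq_square power3_eq_cube)
qed

lemma zero_in_tangent_space: "p \<in> S \<Longrightarrow> 0 \<in> tangent_space S p"
  unfolding tangent_space_def
  by (intro CollectI exI[of _ "\<lambda>_. p"] exI[of _ 1]) auto

text \<open>The curve is parametrised by its first coordinate. Along it a single explicit normal
  vector bounds both suprema from below.\<close>

lemma W_plane_curve:
  assumes "0 < \<epsilon>" "0 < a" "a < 1"
  defines "y \<equiv> \<lambda>x. vector [x, a * exp (ln a / x\<^sup>2), exp (ln a / x\<^sup>2)] :: real^3"
  shows "filterlim y (at 0 within W \<epsilon> \<inter> plane a) (at_right 0)"
    and "\<forall>\<^sub>F x in at_right 0. 1/2 \<le> normal_part (tangent_space (W \<epsilon> \<inter> plane a) (y x))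
        ((closest_point x_axis (y x) - y x) /\<^sub>R norm (closest_point x_axis (y x) - y x))"
    and "\<forall>\<^sub>F x in at_right 0. - ln a \<le> norm (y x - 0) *
        delta (tangent_space x_axis (closest_point x_axis (y x)))
          (tangent_space (W \<epsilon> \<inter> plane a) (y x)) / norm (y x - closest_point x_axis (y x))"
proof -
  define k where "k = - ln a"
  have k: "k > 0" using assms by (simp add: k_def)
  \<comment> \<open>\<open>z\<close> is the height along the curve and \<open>m\<close> is its
    derivative; \<open>z\<close> decays faster than any power of \<open>x\<close>, so
    \<open>m\<close> tends to 0 as well.\<close>
  define z m where "z x = exp (ln a / x\<^sup>2)" and "m x = 2 * k * z x / x ^ 3" for x :: real
  have "z = (\<lambda>x. exp (- k / x\<^sup>2))"
    by (simp add: z_def k_def fun_eq_iff)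
  then have z0: "(z \<longlongrightarrow> 0) (at_right 0)" and m0: "(m \<longlongrightarrow> 0) (at_right 0)"
    using k unfolding m_def by (simp, real_asymp)+
  have y_nth: "y x $ 1 = x" "y x $ 2 = a * z x" "y x $ 3 = z x" for x
    by (simp_all add: y_def z_def)
  have z_pos: "z x > 0" for x
    by (simp add: z_def)
  \<comment> \<open>\<open>m x < 1\<close> serves the bound on the normal vector,
    \<open>x < 1\<close> the final estimate for (r).\<close>
  have small: "\<forall>\<^sub>F x in at_right 0. 0 < x \<and> x < \<epsilon> \<and> x < 1 \<and> z x < \<epsilon> \<and> m x < 1"
    using order_tendstoD(2)[OF z0 assms(1)] order_tendstoD(2)[OF m0 zero_less_one]
      eventually_at_right_real[OF assms(1)] eventually_at_right_real[OF zero_less_one]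
    by eventually_elim auto
  have on_curve: "\<forall>\<^sub>F x in at_right 0. y x \<in> W \<epsilon> \<inter> plane a"
    using small
  proof eventually_elim
    case (elim x)
    then show ?case
      unfolding W_plane_iff[OF assms(2)] y_nth using z_pos by (auto simp: z_def)
  qed
  have "(y \<longlongrightarrow> 0) (at_right 0)"
  proof (rule vec_tendstoI)
    fix i :: 3
    have "((\<lambda>x. x) \<longlongrightarrow> (0::real)) (at_right 0)" "((\<lambda>x. a * z x) \<longlongrightarrow> 0) (at_right 0)"
      using tendsto_mult_right_zero[OF z0] by (auto intro: tendsto_eq_intros)
    then show "((\<lambda>x. y x $ i) \<longlongrightarrow> 0 $ i) (at_right 0)"
      using z0 exhaust_3[of i] by (auto simp: y_nth)
  qed
  moreover have "y x \<noteq> 0" for x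
    by (metis y_nth(3) z_pos zero_index less_irrefl)
  ultimately show "filterlim y (at 0 within W \<epsilon> \<inter> plane a) (at_right 0)"
    using on_curve by (auto simp: filterlim_at elim: eventually_mono)
  \<comment> \<open>The tangent direction is (1, a*m, m). Adding m*(a^2+1) along the axis to the
    secant direction (0, -a, -1) makes it orthogonal to this tangent.\<close>
  define \<nu> :: "real \<Rightarrow> real^3" where "\<nu> x = vector [m x * (a\<^sup>2 + 1), - a, - 1]" for x
  have \<nu>_nz: "\<nu> x \<noteq> 0" for x
    by (metis \<nu>_def vector_3(3) zero_index neg_equal_0_iff_equal zero_neq_one)
  define s where "s = sqrt (a\<^sup>2 + 1)"
  have s: "s > 0" "s\<^sup>2 = a\<^sup>2 + 1"
    by (auto simp: s_def add_nonneg_pos)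
  \<comment> \<open>The squared norm is s^2*(m^2*s^2 + 1), with m < 1 and s^2 \<le> 2; rounding the
    factor 3 up to 4 leaves a perfect square.\<close>
  have norm_\<nu>: "norm (\<nu> x) \<le> 2 * s" if "0 < x" "m x < 1" for x
  proof -
    have "m x \<ge> 0"
      using that k z_pos[of x] by (simp add: m_def)
    have "a\<^sup>2 \<le> 1"
      using assms by (simp add: power_le_one)
    then have "(m x)\<^sup>2 * s\<^sup>2 \<le> 1 * 2"
      unfolding s(2) using that \<open>m x \<ge> 0\<close> by (intro mult_mono) (auto simp: power_le_one)
    then have "s\<^sup>2 * ((m x)\<^sup>2 * s\<^sup>2 + 1) \<le> s\<^sup>2 * 4"
      by (intro mult_left_mono) auto
    moreover have "(norm (\<nu> x))\<^sup>2 = s\<^sup>2 * ((m x)\<^sup>2 * s\<^sup>2 + 1)"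
      unfolding s(2) power2_norm_eq_inner
      by (simp add: \<nu>_def inner_vec_def sum_3 power2_eq_square algebra_simps)
    ultimately have "(norm (\<nu> x))\<^sup>2 \<le> (2 * s)\<^sup>2"
      by (simp add: power_mult_distrib)
    then show ?thesis
      by (rule power2_le_imp_le) (use s(1) in simp)
  qed
  have \<nu>_orth: "\<nu> x \<in> (tangent_space (W \<epsilon> \<inter> plane a) (y x))\<^sup>\<bottom>"
    if "0 < x" "y x \<in> W \<epsilon> \<inter> plane a" for x
    unfolding orthogonal_comp_def orthogonal_def
  proof (intro CollectI ballI)
    fix v assume "v \<in> tangent_space (W \<epsilon> \<inter> plane a) (y x)"
    from tangent_space_W_plane[OF assms(2) that(2) _ this] that(1)
    have "v $ 2 = a * v $ 3" "v $ 3 = m x * v $ 1"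
      by (auto simp: y_nth m_def k_def)
    then show "v \<bullet> \<nu> x = 0"
      by (simp add: \<nu>_def inner_vec_def sum_3 algebra_simps power2_eq_square)
  qed
  have diff: "closest_point x_axis (y x) - y x = z x *\<^sub>R vector [0, - a, - 1]" for x
    by (simp add: closest_point_x_axis vec_eq_iff forall_3 y_nth)
  have "norm (vector [0, - a, - 1] :: real^3) = s"
    by (simp add: s_def norm_eq_sqrt_inner inner_vec_def sum_3 power2_eq_square)
  then have norm_diff: "norm (closest_point x_axis (y x) - y x) = z x * s" for x
    using z_pos[of x] by (simp add: diff)
  show "\<forall>\<^sub>F x in at_right 0. 1/2 \<le> normal_part (tangent_space (W \<epsilon> \<inter> plane a) (y x))
        ((closest_point x_axis (y x) - y x) /\<^sub>R norm (closest_point x_axis (y x) - y x))"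
    using small on_curve
  proof eventually_elim
    case (elim x)
    \<comment> \<open>Against the unit secant \<open>\<nu> x\<close> gives s^2/s = s, and dividing
      by its norm, at most 2*s, leaves at least 1/2.\<close>
    have "\<nu> x \<bullet> vector [0, - a, - 1] = s\<^sup>2"
      unfolding s(2) by (simp add: \<nu>_def inner_vec_def sum_3 power2_eq_square)
    then have "\<nu> x \<bullet> ((closest_point x_axis (y x) - y x) /\<^sub>R (z x * s)) = s"
      using z_pos[of x] s(1) by (simp add: diff power2_eq_square field_simps)
    moreover have "1/2 \<le> s / norm (\<nu> x)"
      using norm_\<nu>[of x] elim \<nu>_nz[of x] by (simp add: field_simps)
    ultimately show ?case
      unfolding norm_diff using normal_part_ge[OF \<nu>_orth \<nu>_nz, of x] elim by (metis order_trans)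
  qed
  show "\<forall>\<^sub>F x in at_right 0. - ln a \<le> norm (y x - 0) *
        delta (tangent_space x_axis (closest_point x_axis (y x)))
          (tangent_space (W \<epsilon> \<inter> plane a) (y x)) / norm (y x - closest_point x_axis (y x))"
    using small on_curve
  proof eventually_elim
    case (elim x)
    let ?\<delta> = "delta (tangent_space x_axis (closest_point x_axis (y x)))
          (tangent_space (W \<epsilon> \<inter> plane a) (y x))"
    have "closest_point x_axis (y x) \<in> x_axis"
      unfolding closest_point_x_axis by (auto simp: x_axis_def)
    then have "axis 1 1 \<in> tangent_space x_axis (closest_point x_axis (y x))"
      using tangent_space_subspace[OF subspace_x_axis] by (simp add: x_axis_eq_span span_base)
    \<comment> \<open>The unit vector of the axis is the test vector for
      \<open>delta\<close>.\<close>
    then have "axis 1 1 \<bullet> \<nu> x / norm (\<nu> x) \<le> ?\<delta>"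
      using elim by (intro delta_ge zero_in_tangent_space \<nu>_orth \<nu>_nz) auto
    moreover have "axis 1 1 \<bullet> \<nu> x = m x * s\<^sup>2"
      unfolding s(2) by (simp add: \<nu>_def inner_axis')
    moreover have "m x * s\<^sup>2 / (2 * s) \<le> m x * s\<^sup>2 / norm (\<nu> x)"
      using norm_\<nu>[of x] elim \<nu>_nz[of x] k z_pos[of x] s(1)
      by (intro divide_left_mono) (auto simp: m_def)
    moreover have "m x * s\<^sup>2 / (2 * s) = m x * s / 2"
      using s(1) by (simp add: power2_eq_square)
    ultimately have \<delta>: "m x * s / 2 \<le> ?\<delta>"
      by (simp only: order_trans)
    have "x \<le> norm (y x)"
      using component_le_norm_cart[of "y x" 1] elim by (simp add: y_nth)
    then have "x * (m x * s / 2) \<le> norm (y x) * ?\<delta>"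
      using \<delta> elim k z_pos[of x] s(1) by (intro mult_mono) (auto simp: m_def)
    then have "x * (m x * s / 2) / (z x * s) \<le> norm (y x) * ?\<delta> / (z x * s)"
      using z_pos[of x] s(1) by (intro divide_right_mono) auto
    \<comment> \<open>The factor \<open>z\<close> in \<open>m\<close> cancels against the distance
      to the axis, so the quotient in (r) is at least k/x^2.\<close>
    moreover have "x * (m x * s / 2) / (z x * s) = k / x\<^sup>2"
      using elim z_pos[of x] s(1) by (simp add: m_def field_simps power2_eq_square power3_eq_cube)
    moreover have "k \<le> k / x\<^sup>2"
    proof -
      have "x\<^sup>2 \<le> 1"
        using elim by (simp add: power_le_one)
      then show ?thesis
        using k elim by (simp add: pos_le_divide_eq mult_left_le)
    qed
    ultimately show ?case
      using norm_diff[of x] by (simp add: norm_minus_commute k_def)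
  qed
qed

section \<open>Failure of both starred conditions\<close>

text \<open>A plane in the dense set is itself an admissible \<open>N\<close>: it contains the axis
  and is its own tangent space at 0.\<close>

lemma not_star_regular_W:
  assumes "\<And>a. 0 < a \<Longrightarrow> a < 1 \<Longrightarrow> \<not> E (W \<epsilon> \<inter> plane a) x_axis 0"
  shows "\<not> star_regular E (W \<epsilon>) x_axis 0"
proof
  have T: "tangent_space x_axis 0 = x_axis"
    by (simp add: tangent_space_subspace subspace_x_axis subspace_0)
  assume "star_regular E (W \<epsilon>) x_axis 0"
  \<comment> \<open>The axis has codimension 2, so \<open>k = 1\<close> is admissible.\<close>
  then have "cod_regular E 1 (W \<epsilon>) x_axis 0"
    unfolding star_regular_def T dim_x_axis by simp
  then obtain \<U> where "grassmannian 1 x_axis closure_of \<U> = topspace (grassmannian 1 x_axis)"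
    and E: "\<And>N. C2_submanifold 2 N \<Longrightarrow> x_axis \<subseteq> N \<Longrightarrow> tangent_space N 0 \<in> \<U>
      \<Longrightarrow> E (W \<epsilon> \<inter> N) x_axis 0"
    unfolding cod_regular_def T by (fastforce intro: always_eventually)
  then obtain a where a: "0 < a" "a < 1" "plane a \<in> \<U>"
    using dense_grassmannian_contains_plane by blast
  have "C2_submanifold 2 (plane a)"
    using C2_submanifold_subspace[OF subspace_plane] dim_plane by metis
  moreover have "x_axis \<subseteq> plane a"
    by (auto simp: x_axis_def plane_def)
  moreover have "tangent_space (plane a) 0 = plane a"
    by (simp add: tangent_space_subspace subspace_plane subspace_0)
  ultimately show False
    using E assms a by metis
qed

text \<open>A limit along \<open>F\<close> passes to the path \<open>y\<close>, where the positive
  lower bound survives in the limit.\<close>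

lemma not_tendsto_0_if_ge:
  fixes f :: "'a \<Rightarrow> real"
  assumes "filterlim y F G" "G \<noteq> bot" "0 < c" "\<forall>\<^sub>F x in G. c \<le> f (y x)"
  shows "\<not> (f \<longlongrightarrow> 0) F"
  using tendsto_lowerbound[OF filterlim_compose[OF _ assms(1)] assms(4,2)] assms(3) by fastforce

theorem mainTheorem12:
  fixes \<epsilon> :: real
  assumes "0 < \<epsilon>"
  shows "\<not> star_regular condition_b (W \<epsilon>) x_axis 0 \<and> \<not> star_regular condition_r (W \<epsilon>) x_axis 0"
proof (intro conjI not_star_regular_W)
  fix a :: real assume a: "0 < a" "a < 1"
  note curve = W_plane_curve[OF assms a]
  \<comment> \<open>The second limit in (b) is the one refuted, with lower bound 1/2.\<close>
  show "\<not> condition_b (W \<epsilon> \<inter> plane a) x_axis 0"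
    unfolding condition_b_def
    using not_tendsto_0_if_ge[OF curve(1) trivial_limit_at_right_real _ curve(2)] by simp
  \<comment> \<open>The lower bound \<open>- ln a\<close> is positive because
    \<open>a < 1\<close>.\<close>
  show "\<not> condition_r (W \<epsilon> \<inter> plane a) x_axis 0"
    unfolding condition_r_def
    using not_tendsto_0_if_ge[OF curve(1) trivial_limit_at_right_real _ curve(3)] a by simp
qed

end
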